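(* Let $\mathcal H$ be a real Hilbert space; let $f,g,h:\mathcal H\to(-\infty,\infty]$ be proper closed convex functions with $\nabla h$ $(1/\beta_h)$-Lipschitz; let $\overline A,\overline B,\overline C$ be monotone operators on $\mathcal H$ with $\overline C$ $\beta_{\overline C}$-cocoercive; let $A=\partial f+\overline A$ and $B=\partial g+\overline B$ be maximal monotone, and let $C=\nabla h+\overline C$, with $\beta>0$ a cocoercivity constant of $C$. Let $\varepsilon\in(0,1)$, $\gamma\in(0,2\beta\varepsilon)$, $\alpha=1/(2-\varepsilon)$, $(\lambda_j)_{j\ge0}\subseteq(0,1/\alpha)$ with $\underline\tau:=\inf_{j\ge0}\lambda_j(1-\alpha\lambda_j)/\alpha>0$. Let $T:=I_{\mathcal H}-J_{\gamma B}+J_{\gamma A}\circ(2J_{\gamma B}-I_{\mathcal H}-\gamma C\circ J_{\gamma B})$ have a fixed point $z^\ast$, and let $x^\ast=J_{\gamma B}(z^\ast)$. Let $z^0\in\mathcal H$, $z^{k+1}=(1-\lambda_k)z^k+\lambda_kTz^k$ for $k\ge 0$, and let $x_A^k,x_B^k,u_{\overline A}^k,u_{\overline B}^k$ be as defined in the context. Then: 1. For all $k\ge0$ and $x\in\mathrm{dom}(f)\cap\mathrm{dom}(g)$, $$f(x_A^k)+g(x_B^k)+h(x_B^k)-(f+g+h)(x)+\langle x_A^k-x,u_{\overline A}^k\rangle+\langle x_B^k-x,u_{\overline B}^k+\overline Cx_B^k\rangle\le\frac{\left(\|z^\ast-x\|+(1+\gamma/\beta)\|z^0-z^\ast\|+\gamma\|Cx^\ast\|\right)\|z^0-z^\ast\|}{\gamma\sqrt{\underline\tau(k+1)}}.$$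 2. Suppose $f$ and $\overline A$ are, respectively, $L_f$- and $L_{\overline A}$-Lipschitz continuous on the closed ball of center $x^\ast$ and radius $(1+\gamma/\beta)\|z^0-z^\ast\|$. Then for all $k\ge0$ and $x\in\mathrm{dom}(f)\cap\mathrm{dom}(g)$, $$\begin{aligned}&f(x_B^k)+g(x_B^k)+h(x_B^k)-(f+g+h)(x)+\langle x_B^k-x,\overline Ax_B^k+u_{\overline B}^k+\overline Cx_B^k\rangle\\&\le\frac{\left(\|z^\ast-x\|+(1+\gamma/\beta)\|z^0-z^\ast\|+\gamma\|Cx^\ast\|\right)\|z^0-z^\ast\|+\gamma L_f\|z^0-z^\ast\|}{\gamma\sqrt{\underline\tau(k+1)}}\\&\quad+\frac{(1+L_{\overline A})\|z^0-z^\ast\|\left((1+\gamma/\beta)(1+L_{\overline A})\|z^0-z^\ast\|+\|\overline Ax^\ast\|+\|x^\ast-x\|\right)}{\sqrt{\underline\tau(k+1)}},\end{aligned}$$ and $$f(x_B^k)+g(x_B^k)+h(x_B^k)-(f+g+h)(x)+\langle x_B^k-x,\overline Ax_B^k+u_{\overline B}^k+\overline Cx_B^k\rangle=o\left(\frac{1+\|x\|}{\sqrt{k+1}}\right).$$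
   Context: $I_{\mathcal H}$ is the identity and $J_S:=(I_{\mathcal H}+S)^{-1}$ is the resolvent of $S$; $\partial$ is the convex subdifferential; an operator $C$ is $\beta$-cocoercive if $\langle Cx-Cy,x-y\rangle\ge\beta\|Cx-Cy\|^2$ for all $x,y$. Notation: $x_B^k:=J_{\gamma B}(z^k)$, $x_A^k:=J_{\gamma A}(2x_B^k-z^k-\gamma Cx_B^k)$, $u_B^k:=\gamma^{-1}(z^k-x_B^k)\in Bx_B^k$, $u_A^k:=\gamma^{-1}(2x_B^k-z^k-\gamma Cx_B^k-x_A^k)\in Ax_A^k$. Decompositions $u_A^k=\widetilde\nabla f(x_A^k)+u_{\overline A}^k$ with $\widetilde\nabla f(x_A^k)\in\partial f(x_A^k)$, $u_{\overline A}^k\in\overline Ax_A^k$, and $u_B^k=\widetilde\nabla g(x_B^k)+u_{\overline B}^k$ with $\widetilde\nabla g(x_B^k)\in\partial g(x_B^k)$, $u_{\overline B}^k\in\overline Bx_B^k$, are fixed. In part 2, Lipschitz continuity of $\overline A$ includes being single-valued on the ball.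
   Formalization: The final estimate is proved as an upper bound: the expression is at most (1+‖x‖)e_k with e_k=o(1/√(k+1)) independent of x; the literal two-sided "= o(...)" is false (f(y)=y² on the real line, all else zero, x=1 gives limit −1). *)

theory Defs
  imports "HOL-Analysis.Analysis" "HOL-Library.Landau_Symbols"
begin

text \<open>
  A real Hilbert space is a type of class \<^class>\<open>real_inner\<close> and \<^class>\<open>complete_space\<close>.
  Extended-real-valued functions have type \<open>'a \<Rightarrow> ereal\<close>; set-valued operators have
  type \<open>'a \<Rightarrow> 'a set\<close>, and sums of them are pointwise Minkowski sums.
\<close>

definition edom :: "('a \<Rightarrow> ereal) \<Rightarrow> 'a set" where
  "edom f = {x. f x < \<infinity>}"

definition epi :: "('a \<Rightarrow> ereal) \<Rightarrow> ('a \<times> real) set" where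
  "epi f = {(x, r). f x \<le> ereal r}"

definition proper_closed_convex :: "('a::real_normed_vector \<Rightarrow> ereal) \<Rightarrow> bool" where
  "proper_closed_convex f \<longleftrightarrow>
     (\<forall>x. f x \<noteq> -\<infinity>) \<and> edom f \<noteq> {} \<and> closed (epi f) \<and> convex (epi f)"

text \<open>For proper \<open>f\<close> this set is empty outside the domain of \<open>f\<close>.\<close>
definition subdifferential :: "('a::real_inner \<Rightarrow> ereal) \<Rightarrow> 'a \<Rightarrow> 'a set" where
  "subdifferential f x = {u. \<forall>y. f x + ereal (u \<bullet> (y - x)) \<le> f y}"

text \<open>Differentiability on the whole space forces the function to be finite everywhere.\<close>
definition has_gradient :: "('a::real_inner \<Rightarrow> ereal) \<Rightarrow> ('a \<Rightarrow> 'a) \<Rightarrow> bool" where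
  "has_gradient h dh \<longleftrightarrow>
     (\<forall>x. \<bar>h x\<bar> \<noteq> \<infinity>) \<and> (\<forall>x. GDERIV (\<lambda>y. real_of_ereal (h y)) x :> dh x)"

definition elipschitz_on :: "real \<Rightarrow> 'a::metric_space set \<Rightarrow> ('a \<Rightarrow> ereal) \<Rightarrow> bool" where
  "elipschitz_on L S f \<longleftrightarrow>
     (\<forall>x\<in>S. \<bar>f x\<bar> \<noteq> \<infinity>) \<and> L-lipschitz_on S (\<lambda>x. real_of_ereal (f x))"

text \<open>Lipschitz continuity of a set-valued operator includes being single-valued
  (with nonempty values) on the set; the value is then \<open>the_elem (S x)\<close>.\<close>
definition op_lipschitz_on :: "real \<Rightarrow> 'a::metric_space set \<Rightarrow> ('a \<Rightarrow> 'a set) \<Rightarrow> bool" where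
  "op_lipschitz_on L X S \<longleftrightarrow>
     (\<forall>x\<in>X. is_singleton (S x)) \<and> L-lipschitz_on X (\<lambda>x. the_elem (S x))"

definition monotone_op :: "('a::real_inner \<Rightarrow> 'a set) \<Rightarrow> bool" where
  "monotone_op S \<longleftrightarrow>
     (\<forall>x y. \<forall>u\<in>S x. \<forall>v\<in>S y. 0 \<le> (u - v) \<bullet> (x - y))"

text \<open>The order on operators is pointwise inclusion, that is, inclusion of graphs.\<close>
definition maximal_monotone_op :: "('a::real_inner \<Rightarrow> 'a set) \<Rightarrow> bool" where
  "maximal_monotone_op S \<longleftrightarrow>
     monotone_op S \<and> (\<forall>M. monotone_op M \<and> S \<le> M \<longrightarrow> M = S)"

definition cocoercive :: "real \<Rightarrow> ('a::real_inner \<Rightarrow> 'a) \<Rightarrow> bool" where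
  "cocoercive \<beta> C \<longleftrightarrow> (\<forall>x y. \<beta> * (norm (C x - C y))\<^sup>2 \<le> (C x - C y) \<bullet> (x - y))"

definition scale_op :: "real \<Rightarrow> ('a::real_vector \<Rightarrow> 'a set) \<Rightarrow> 'a \<Rightarrow> 'a set" where
  "scale_op c S x = (\<lambda>u. c *\<^sub>R u) ` S x"

text \<open>The value at \<open>z\<close> of the inverse of \<open>I + S\<close>, as a single-valued map. For maximal monotone
  \<open>S\<close> on a Hilbert space the described point exists and is unique (Minty).\<close>
definition resolvent :: "('a::real_vector \<Rightarrow> 'a set) \<Rightarrow> 'a \<Rightarrow> 'a" where
  "resolvent S z = (THE x. z \<in> {x} + S x)"

definition splitting_op ::
    "real \<Rightarrow> ('a::real_vector \<Rightarrow> 'a set) \<Rightarrow> ('a \<Rightarrow> 'a set) \<Rightarrow> ('a \<Rightarrow> 'a) \<Rightarrow> 'a \<Rightarrow> 'a" where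
  "splitting_op \<gamma> A B C z =
     z - resolvent (scale_op \<gamma> B) z
       + resolvent (scale_op \<gamma> A)
           (2 *\<^sub>R resolvent (scale_op \<gamma> B) z - z - \<gamma> *\<^sub>R C (resolvent (scale_op \<gamma> B) z))"

end

theory Submission imports Defs begin

text \<open>
  Write \<open>d\<^sub>k = x\<^sub>B\<^sup>k - x\<^sub>A\<^sup>k = z\<^sup>k - T z\<^sup>k\<close>, which equals \<open>\<gamma> (u\<^sub>B\<^sup>k + u\<^sub>A\<^sup>k + C x\<^sub>B\<^sup>k)\<close>.
  Monotonicity of \<open>A\<close>, \<open>B\<close> and cocoercivity of \<open>C\<close> make \<open>T\<close> averaged, so \<open>\<parallel>d\<^sub>k\<parallel>\<close> is nonincreasing
  and square summable, with \<open>\<parallel>d\<^sub>k\<parallel> \<le> \<parallel>z\<^sup>0 - z\<^sup>*\<parallel> / sqrt (\<tau> (k + 1))\<close> and \<open>\<parallel>d\<^sub>k\<parallel> = o(1 / sqrt (k + 1))\<close>.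
  The subgradient inequalities bound the left-hand side of part 1 by
  \<open>\<gamma>\<^sup>-\<^sup>1 \<langle>d\<^sub>k, T z\<^sup>k - x + \<gamma> C x\<^sub>B\<^sup>k\<rangle>\<close>, and Cauchy--Schwarz finishes; part 2 replaces \<open>x\<^sub>A\<^sup>k\<close> by
  \<open>x\<^sub>B\<^sup>k\<close> at Lipschitz cost \<open>\<parallel>d\<^sub>k\<parallel>\<close>.

  Since \<^const>\<open>resolvent\<close> is a definite description, the fixed point \<open>z\<^sup>*\<close> carries information only
  once resolvents of maximal monotone operators are known to be defined everywhere (Minty). This
  follows by minimizing \<open>F + \<parallel>\<cdot>\<parallel>\<^sup>2 / 2\<close> on \<open>H \<times> H\<close>, \<open>F\<close> being the Fitzpatrick function of the operator.
\<close>

subsection \<open>Minty's theorem\<close>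

lemma norm_minus_midpoint_sq:
  fixes a b :: "'a::real_inner"
  shows "(norm (a - b))\<^sup>2 = 2 * (norm a)\<^sup>2 + 2 * (norm b)\<^sup>2 - 4 * (norm ((1/2) *\<^sub>R (a + b)))\<^sup>2"
  by (simp add: power2_norm_eq_inner inner_simps inner_commute algebra_simps)

text \<open>When \<open>E\<close> is an epigraph, this minimizes a closed convex function plus half
  the squared norm, and the conclusion says that \<open>- w0\<close> is a subgradient at the
  minimizer. Strong convexity makes minimizing sequences Cauchy, so completeness supplies the
  minimizer without weak compactness.\<close>

lemma regularized_minimizer:
  fixes E :: "('w::{real_inner, complete_space} \<times> real) set"
  assumes "closed E" "convex E" "E \<noteq> {}"
    and bdd: "\<And>w r. (w, r) \<in> E \<Longrightarrow> 0 \<le> r + (norm w)\<^sup>2 / 2"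
  obtains w0 r0 where "(w0, r0) \<in> E" "\<And>w r. (w, r) \<in> E \<Longrightarrow> r0 - w0 \<bullet> (w - w0) \<le> r"
proof -
  define q where "q e = snd e + (norm (fst e))\<^sup>2 / 2" for e :: "'w \<times> real"
  define m where "m = Inf (q ` E)"
  have bb: "bdd_below (q ` E)"
    by (rule bdd_belowI[of _ 0]) (use bdd in \<open>auto simp: q_def\<close>)
  have mle: "m \<le> q e" if "e \<in> E" for e
    unfolding m_def using bb that by (simp add: cInf_lower)
  have "\<exists>e\<in>E. q e < m + 1 / real (Suc n)" for n
  proof -
    have "Inf (q ` E) < m + 1 / real (Suc n)" unfolding m_def by simp
    then show ?thesis using cInf_lessD[of "q ` E"] \<open>E \<noteq> {}\<close> by blast
  qed
  then obtain e where e: "\<And>n. e n \<in> E" "\<And>n. q (e n) < m + 1 / real (Suc n)" by metis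
  define w where "w n = fst (e n)" for n
  \<comment> \<open>The midpoint of \<open>e i\<close> and \<open>e j\<close> lies in
    \<open>E\<close> and so has value at least \<open>m\<close>; the parallelogram identity turns
    this into a bound on the distance.\<close>
  have est: "(norm (w i - w j))\<^sup>2 \<le> 4 / real (Suc i) + 4 / real (Suc j)" for i j
  proof -
    have "(1/2) *\<^sub>R (e i) + (1/2) *\<^sub>R (e j) \<in> E"
      using \<open>convex E\<close> e by (simp add: convex_def)
    then have "m \<le> q ((1/2) *\<^sub>R (e i) + (1/2) *\<^sub>R (e j))" by (rule mle)
    then have "2 * m \<le> q (e i) + q (e j) - (norm (w i - w j))\<^sup>2 / 4"
      unfolding q_def w_def norm_minus_midpoint_sq[of "fst (e i)"]
      by (simp add: scaleR_add_right field_simps)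
    then show ?thesis using e(2)[of i] e(2)[of j] by linarith
  qed
  have "Cauchy w"
  proof (rule metric_CauchyI)
    fix s :: real assume s: "0 < s"
    obtain N where N: "8 / s\<^sup>2 < real N" using reals_Archimedean2 by blast
    then have N': "0 < real N" using s by (smt (verit) divide_pos_pos zero_less_power)
    show "\<exists>M. \<forall>i\<ge>M. \<forall>j\<ge>M. dist (w i) (w j) < s"
    proof (intro exI allI impI)
      fix i j assume ij: "N \<le> i" "N \<le> j"
      have "4 / real (Suc i) \<le> 4 / real N" "4 / real (Suc j) \<le> 4 / real N"
        using ij N' by (auto intro!: divide_left_mono)
      moreover have "8 / real N < s\<^sup>2" using N N' s by (simp add: field_simps)
      ultimately have "(norm (w i - w j))\<^sup>2 < s\<^sup>2" using est[of i j] by linarith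
      then show "dist (w i) (w j) < s" using s by (simp add: dist_norm power_less_imp_less_base)
    qed
  qed
  then obtain w0 where w0: "w \<longlonglongrightarrow> w0" using Cauchy_convergent convergent_def by blast
  have "(\<lambda>n. q (e n)) \<longlonglongrightarrow> m"
  proof (rule tendsto_sandwich[OF _ _ tendsto_const])
    show "(\<lambda>n. m + 1 / real (Suc n)) \<longlonglongrightarrow> m"
      using tendsto_add[OF tendsto_const LIMSEQ_inverse_real_of_nat, of m] by (simp add: inverse_eq_divide)
  qed (auto intro!: always_eventually mle e(1) less_imp_le[OF e(2)] simp del: of_nat_Suc)
  then have "(\<lambda>n. q (e n) - (norm (w n))\<^sup>2 / 2) \<longlonglongrightarrow> m - (norm w0)\<^sup>2 / 2"
    by (intro tendsto_intros w0) simp_all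
  moreover define r0 where "r0 = m - (norm w0)\<^sup>2 / 2"
  ultimately have "(\<lambda>n. snd (e n)) \<longlonglongrightarrow> r0" by (simp add: q_def w_def)
  with w0 have "(\<lambda>n. (w n, snd (e n))) \<longlonglongrightarrow> (w0, r0)" by (intro tendsto_Pair)
  then have "e \<longlonglongrightarrow> (w0, r0)" by (simp add: w_def)
  then have mem: "(w0, r0) \<in> E" using closed_sequentially[OF \<open>closed E\<close>] e(1) by blast
  have "r0 - w0 \<bullet> (v - w0) \<le> r" if vr: "(v, r) \<in> E" for v r
  proof -
    \<comment> \<open>Compare with the point at parameter \<open>t\<close> on the segment towards
      \<open>(v, r)\<close> and divide by \<open>t\<close>; letting \<open>t\<close> tend to 0 from
      the right leaves the first-order condition.\<close>
    have "0 \<le> (r - r0 + w0 \<bullet> (v - w0)) + t * ((norm (v - w0))\<^sup>2 / 2)" if t: "0 < t" "t < 1" for t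
    proof -
      have "(1 - t) *\<^sub>R (w0, r0) + t *\<^sub>R (v, r) \<in> E"
        using convexD[OF \<open>convex E\<close> mem vr] t by simp
      from mle[OF this] have "0 \<le> t * (r - r0) + ((norm ((1 - t) *\<^sub>R w0 + t *\<^sub>R v))\<^sup>2 - (norm w0)\<^sup>2) / 2"
        by (simp add: q_def r0_def algebra_simps diff_divide_distrib)
      also have "(1 - t) *\<^sub>R w0 + t *\<^sub>R v = w0 + t *\<^sub>R (v - w0)" by (simp add: algebra_simps)
      also have "(norm (w0 + t *\<^sub>R (v - w0)))\<^sup>2
          = (norm w0)\<^sup>2 + 2 * t * (w0 \<bullet> (v - w0)) + t\<^sup>2 * (norm (v - w0))\<^sup>2"
        unfolding power2_norm_eq_inner
        by (simp add: inner_simps inner_commute algebra_simps power2_eq_square)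
      finally have "0 \<le> t * ((r - r0 + w0 \<bullet> (v - w0)) + t * ((norm (v - w0))\<^sup>2 / 2))"
        by (simp add: algebra_simps power2_eq_square add_divide_distrib diff_divide_distrib)
      then show ?thesis using t by (simp add: zero_le_mult_iff)
    qed
    then have "eventually (\<lambda>t. 0 \<le> (r - r0 + w0 \<bullet> (v - w0)) + t * ((norm (v - w0))\<^sup>2 / 2)) (at_right 0)"
      by (auto simp: eventually_at_right_field intro!: exI[of _ 1])
    moreover have "((\<lambda>t. (r - r0 + w0 \<bullet> (v - w0)) + t * ((norm (v - w0))\<^sup>2 / 2))
        \<longlongrightarrow> (r - r0 + w0 \<bullet> (v - w0)) + 0 * ((norm (v - w0))\<^sup>2 / 2)) (at_right 0)"
      by (intro tendsto_intros)
    ultimately have "0 \<le> (r - r0 + w0 \<bullet> (v - w0)) + 0 * ((norm (v - w0))\<^sup>2 / 2)"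
      by (intro tendsto_lowerbound) (auto simp: trivial_limit_at_right_real)
    then show ?thesis by simp
  qed
  with mem show ?thesis using that by blast
qed

text \<open>At the minimizer \<open>(x0, u0)\<close> of the Fitzpatrick function plus half the
  squared norm, optimality makes \<open>(- u0, - x0)\<close> monotonically related to all of
  \<open>G\<close>, hence a member of \<open>G\<close>. The same condition tested at this very point
  forces \<open>u0 = - x0\<close>.\<close>

lemma maximal_monotone_graph_zero:
  fixes G :: "('a::{real_inner, complete_space} \<times> 'a) set"
  assumes mono: "\<And>x u y v. (x, u) \<in> G \<Longrightarrow> (y, v) \<in> G \<Longrightarrow> 0 \<le> (u - v) \<bullet> (x - y)"
    and max: "\<And>x u. (\<And>y v. (y, v) \<in> G \<Longrightarrow> 0 \<le> (u - v) \<bullet> (x - y)) \<Longrightarrow> (x, u) \<in> G"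
  shows "\<exists>x. (x, - x) \<in> G"
proof -
  \<comment> \<open>the epigraph of the Fitzpatrick function of \<open>G\<close>, which dominates the duality pairing\<close>
  define E :: "(('a \<times> 'a) \<times> real) set"
    where "E = {e. \<forall>p\<in>G. fst (fst e) \<bullet> snd p + fst p \<bullet> snd (fst e) - fst p \<bullet> snd p \<le> snd e}"
  have E_iff: "((x, u), r) \<in> E \<longleftrightarrow> (\<forall>y v. (y, v) \<in> G \<longrightarrow> x \<bullet> v + y \<bullet> u - y \<bullet> v \<le> r)" for x u r
    by (auto simp: E_def)
  \<comment> \<open>A height below the pairing would make \<open>(x, u)\<close> monotonically
    related to \<open>G\<close>, hence a member by maximality; but then the constraint from
    \<open>p = (x, u)\<close> itself reads \<open>x \<bullet> u \<le> r\<close>.\<close>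
  have rel: "x \<bullet> u \<le> r" if xu: "((x, u), r) \<in> E" for x u r
  proof (rule ccontr)
    assume less: "\<not> x \<bullet> u \<le> r"
    have "0 \<le> (u - v) \<bullet> (x - y)" if "(y, v) \<in> G" for y v
    proof -
      have "x \<bullet> v + y \<bullet> u - y \<bullet> v \<le> r" using xu that by (auto simp: E_iff)
      then show ?thesis using less by (simp add: inner_simps inner_commute algebra_simps)
    qed
    then have "(x, u) \<in> G" by (rule max)
    then show False using xu less by (force simp: E_iff)
  qed
  have graph: "((x, u), x \<bullet> u) \<in> E" if "(x, u) \<in> G" for x u
    using mono[OF that] by (auto simp: E_iff inner_simps inner_commute algebra_simps)
  have "closed E"
  proof -
    have "E = (\<Inter>p\<in>G. {e. fst (fst e) \<bullet> snd p + fst p \<bullet> snd (fst e) - fst p \<bullet> snd p \<le> snd e})"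
      by (auto simp: E_def)
    moreover have "closed \<dots>"
      by (intro closed_INT ballI closed_Collect_le continuous_intros)
    ultimately show ?thesis by simp
  qed
  moreover have "convex E"
  proof (rule convexI)
    fix a b :: "('a \<times> 'a) \<times> real" and s t :: real
    assume ab: "a \<in> E" "b \<in> E" and st: "0 \<le> s" "0 \<le> t" "s + t = 1"
    show "s *\<^sub>R a + t *\<^sub>R b \<in> E"
      unfolding E_def
    proof (clarsimp simp del: split_paired_All)
      fix y v assume yv: "(y, v) \<in> G"
      have "s * (fst (fst a) \<bullet> v + y \<bullet> snd (fst a) - y \<bullet> v) \<le> s * snd a"
        "t * (fst (fst b) \<bullet> v + y \<bullet> snd (fst b) - y \<bullet> v) \<le> t * snd b"
        using ab yv st by (force simp: E_def intro!: mult_left_mono)+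
      moreover have "y \<bullet> v = s * (y \<bullet> v) + t * (y \<bullet> v)"
        using st(3) by (simp add: distrib_right[symmetric])
      ultimately show "(s *\<^sub>R fst (fst a) + t *\<^sub>R fst (fst b)) \<bullet> v
          + y \<bullet> (s *\<^sub>R snd (fst a) + t *\<^sub>R snd (fst b)) - y \<bullet> v \<le> s * snd a + t * snd b"
        by (simp add: inner_simps algebra_simps)
    qed
  qed
  moreover have "E \<noteq> {}"
  proof (cases "G = {}")
    case True then show ?thesis by (simp add: E_def)
  next
    case False then show ?thesis using graph by fastforce
  qed
  moreover have "0 \<le> r + (norm w)\<^sup>2 / 2" if "(w, r) \<in> E" for w r
  proof -
    obtain x u where w: "w = (x, u)" by force
    have "0 \<le> (norm (x + u))\<^sup>2 / 2" by simp
    also have "\<dots> = x \<bullet> u + (norm w)\<^sup>2 / 2"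
      unfolding w power2_norm_eq_inner by (simp add: inner_simps inner_commute field_simps)
    finally show ?thesis using rel[of x u r] that w by simp
  qed
  ultimately obtain w0 r0 where
    wr: "(w0, r0) \<in> E" "\<And>w r. (w, r) \<in> E \<Longrightarrow> r0 - w0 \<bullet> (w - w0) \<le> r"
    using regularized_minimizer by blast
  obtain x0 u0 where w0: "w0 = (x0, u0)" by force
  \<comment> \<open>Optimality is tested at \<open>(y, v)\<close> with the admissible height
    \<open>y \<bullet> v\<close>, and \<open>r0\<close> is bounded below by
    \<open>x0 \<bullet> u0\<close>.\<close>
  have key: "(norm (x0 + u0))\<^sup>2 \<le> (- x0 - v) \<bullet> (- u0 - y)" if "(y, v) \<in> G" for y v
    using wr(2)[OF graph[OF that]] rel[of x0 u0 r0] wr(1) unfolding w0 power2_norm_eq_inner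
    by (simp add: inner_simps inner_commute algebra_simps)
  have "(- u0, - x0) \<in> G"
    by (rule max) (use key in \<open>fastforce intro: order_trans[OF zero_le_power2]\<close>)
  moreover from key[OF this] have "u0 = - x0" by (simp add: eq_neg_iff_add_eq_0 add.commute)
  ultimately show ?thesis by auto
qed

text \<open>Adding the pair \<open>(x, u)\<close> to the graph keeps it monotone, so maximality with
  respect to inclusion already forces the pair to belong to it.\<close>

lemma maximal_monotone_op_memI:
  assumes "maximal_monotone_op S" and rel: "\<And>y v. v \<in> S y \<Longrightarrow> 0 \<le> (u - v) \<bullet> (x - y)"
  shows "u \<in> S x"
proof -
  define M where "M = S(x := insert u (S x))"
  have M: "v \<in> M y \<longleftrightarrow> v \<in> S y \<or> (y = x \<and> v = u)" for v y by (auto simp: M_def)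
  have S: "0 \<le> (v - w) \<bullet> (y - z)" if "v \<in> S y" "w \<in> S z" for v w y z
    using assms(1) that by (auto simp: maximal_monotone_op_def monotone_op_def)
  have "monotone_op M"
    unfolding monotone_op_def
  proof (intro allI ballI)
    fix y z v w assume "v \<in> M y" "w \<in> M z"
    then consider "v \<in> S y" "w \<in> S z" | "v \<in> S y" "z = x" "w = u" | "y = x" "v = u" "w \<in> S z"
      | "y = x" "v = u" "z = x" "w = u" by (auto simp: M)
    then show "0 \<le> (v - w) \<bullet> (y - z)"
    proof cases
      case 2 then show ?thesis using rel[of v y] by (simp add: inner_simps)
    qed (use S rel in auto)
  qed
  moreover have "S \<le> M" by (auto simp: le_fun_def M)
  ultimately have "M = S" using assms(1) by (simp add: maximal_monotone_op_def)
  then show ?thesis using M by blast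
qed

text \<open>Scaling by \<open>c\<close> and translating by \<open>- z\<close> preserve maximal
  monotonicity, so the zero found for the shifted graph \<open>G\<close> solves the inclusion for an
  arbitrary \<open>z\<close>.\<close>

lemma minty:
  fixes S :: "'a::{real_inner, complete_space} \<Rightarrow> 'a set"
  assumes S: "maximal_monotone_op S" and c: "0 < c"
  obtains x u where "u \<in> S x" "z = x + c *\<^sub>R u"
proof -
  define G where "G = {(x, c *\<^sub>R u - z) | x u. u \<in> S x}"
  have "\<exists>x. (x, - x) \<in> G"
  proof (rule maximal_monotone_graph_zero)
    fix x u y v assume "(x, u) \<in> G" "(y, v) \<in> G"
    then obtain u' v' where u': "u = c *\<^sub>R u' - z" "u' \<in> S x" and v': "v = c *\<^sub>R v' - z" "v' \<in> S y"
      by (auto simp: G_def)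
    have "0 \<le> c * ((u' - v') \<bullet> (x - y))"
      using S c u' v' by (simp add: maximal_monotone_op_def monotone_op_def)
    then show "0 \<le> (u - v) \<bullet> (x - y)" by (simp add: u' v' inner_simps algebra_simps)
  next
    fix x u assume rel: "\<And>y v. (y, v) \<in> G \<Longrightarrow> 0 \<le> (u - v) \<bullet> (x - y)"
    have "(1 / c) *\<^sub>R (u + z) \<in> S x"
    proof (rule maximal_monotone_op_memI[OF S])
      fix y v assume "v \<in> S y"
      then have "0 \<le> (u - (c *\<^sub>R v - z)) \<bullet> (x - y)" by (intro rel) (auto simp: G_def)
      also have "u - (c *\<^sub>R v - z) = c *\<^sub>R ((1 / c) *\<^sub>R (u + z) - v)"
        using c by (simp add: algebra_simps)
      finally show "0 \<le> ((1 / c) *\<^sub>R (u + z) - v) \<bullet> (x - y)"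
        using c by (simp add: zero_le_mult_iff)
    qed
    then show "(x, u) \<in> G" using c unfolding G_def by force
  qed
  then obtain x u where "u \<in> S x" "- x = c *\<^sub>R u - z" by (auto simp: G_def)
  then show ?thesis using that[of u x] by (simp add: algebra_simps)
qed

text \<open>Uniqueness needs monotonicity only: for two solutions the scaled values differ by
  \<open>- (x - y)\<close>, so their pairing with \<open>x - y\<close> is both nonnegative and minus
  a square.\<close>

lemma resolvent_eqI:
  assumes "monotone_op S" "0 < c" "u \<in> S x" "z = x + c *\<^sub>R u"
  shows "resolvent (scale_op c S) z = x"
  unfolding resolvent_def
proof (rule the_equality)
  show "z \<in> {x} + scale_op c S x" using assms by (auto simp: scale_op_def set_plus_def)
  fix y assume "z \<in> {y} + scale_op c S y"
  then obtain v where v: "v \<in> S y" "z = y + c *\<^sub>R v" by (auto simp: scale_op_def set_plus_def)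
  have "0 \<le> c * ((u - v) \<bullet> (x - y))"
    using assms v by (simp add: monotone_op_def)
  also have "\<dots> = (c *\<^sub>R u - c *\<^sub>R v) \<bullet> (x - y)" by (simp add: inner_simps algebra_simps)
  also have "c *\<^sub>R u - c *\<^sub>R v = - (x - y)" using v assms(4) by (simp add: algebra_simps)
  finally have "(x - y) \<bullet> (x - y) \<le> 0"
    by (metis inner_minus_left neg_0_le_iff_le)
  then show "y = x" by (metis inner_ge_zero inner_eq_zero_iff order_antisym right_minus_eq)
qed

text \<open>This turns the definite description into a usable inclusion, with existence from Minty's
  theorem and uniqueness from monotonicity.\<close>

lemma resolvent_mem:
  fixes S :: "'a::{real_inner, complete_space} \<Rightarrow> 'a set"
  assumes "maximal_monotone_op S" "0 < c"
  shows "(1 / c) *\<^sub>R (z - resolvent (scale_op c S) z) \<in> S (resolvent (scale_op c S) z)"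
proof -
  obtain x u where xu: "u \<in> S x" "z = x + c *\<^sub>R u" using minty assms by blast
  then have "resolvent (scale_op c S) z = x"
    using assms by (intro resolvent_eqI) (auto simp: maximal_monotone_op_def)
  then show ?thesis using xu assms(2) by simp
qed

subsection \<open>Averaged iterations\<close>

text \<open>The upper half of the indices up to \<open>n\<close> contains at least
  \<open>(n + 1) / 2\<close> terms, each at least \<open>a n\<close>, and the sum over this half
  tends to 0 as a difference of partial sums.\<close>

lemma decseq_summable_imp_mult_tendsto_0:
  fixes a :: "nat \<Rightarrow> real"
  assumes "decseq a" "summable a"
  shows "(\<lambda>n. real (Suc n) * a n) \<longlonglongrightarrow> 0"
proof -
  have nn: "0 \<le> a n" for n
    using decseq_ge[OF \<open>decseq a\<close> summable_LIMSEQ_zero[OF \<open>summable a\<close>]] .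
  let ?S = "\<lambda>n. sum a {..<n}"
  have bound: "real (Suc n) * a n \<le> 2 * (?S (Suc n) - ?S (Suc n div 2))" for n
  proof -
    have "real (Suc n) \<le> 2 * real (card {Suc n div 2..<Suc n})" by simp
    then have "real (Suc n) * a n \<le> 2 * real (card {Suc n div 2..<Suc n}) * a n"
      using nn by (intro mult_right_mono) auto
    also have "\<dots> = 2 * (\<Sum>i\<in>{Suc n div 2..<Suc n}. a n)" by simp
    also have "\<dots> \<le> 2 * (\<Sum>i\<in>{Suc n div 2..<Suc n}. a i)"
      using \<open>decseq a\<close> by (intro mult_left_mono sum_mono) (auto simp: decseq_def)
    also have "(\<Sum>i\<in>{Suc n div 2..<Suc n}. a i) = ?S (Suc n) - ?S (Suc n div 2)"
    proof -
      have "Suc n div 2 \<le> Suc n" by simp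
      from sum_diff_nat_ivl[of 0 "Suc n div 2" "Suc n" a] this show ?thesis
        by (simp only: atLeast0LessThan)
    qed
    finally show ?thesis .
  qed
  have "filterlim (\<lambda>n. Suc n div 2) sequentially sequentially"
    unfolding filterlim_at_top
  proof
    fix Z show "\<forall>\<^sub>F n in sequentially. Z \<le> Suc n div 2"
      unfolding eventually_sequentially by (rule exI[of _ "2 * Z"]) auto
  qed
  from filterlim_compose[OF summable_LIMSEQ[OF \<open>summable a\<close>] this]
  have "(\<lambda>n. 2 * (?S (Suc n) - ?S (Suc n div 2))) \<longlonglongrightarrow> 2 * (suminf a - suminf a)"
    by (intro tendsto_mult tendsto_diff tendsto_const LIMSEQ_Suc[OF summable_LIMSEQ[OF \<open>summable a\<close>]])
  then have lim: "(\<lambda>n. 2 * (?S (Suc n) - ?S (Suc n div 2))) \<longlonglongrightarrow> 0" by simp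
  show ?thesis
    by (rule tendsto_sandwich[OF _ _ tendsto_const lim])
      (rule always_eventually, use nn bound in blast | simp add: nn)+
qed

text \<open>Here \<open>d\<close> is the displacement \<open>z - T z\<close> of an operator \<open>T\<close> that is averaged with constant \<open>1 / a\<close>.\<close>
lemma krasnoselskii_mann:
  fixes z d :: "nat \<Rightarrow> 'a::real_inner"
  assumes step: "\<And>k. z (Suc k) = z k - lam k *\<^sub>R d k"
    and lam: "\<And>k. 0 < lam k" "\<And>k. lam k < a"
    and \<tau>: "0 < \<tau>" "\<And>k. \<tau> \<le> lam k * (a - lam k)"
    and fix_gap: "\<And>k. a / 2 * (norm (d k))\<^sup>2 \<le> (z k - zs) \<bullet> d k"
    and pair_gap: "\<And>j k. a / 2 * (norm (d j - d k))\<^sup>2 \<le> (z j - z k) \<bullet> (d j - d k)"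
  shows "norm (z k - zs) \<le> norm (z 0 - zs)"
    and "norm (d k) \<le> norm (z 0 - zs) / sqrt (\<tau> * real (k + 1))"
    and "(\<lambda>k. sqrt (real (k + 1)) * norm (d k)) \<longlonglongrightarrow> 0"
proof -
  define D where "D = norm (z 0 - zs)"
  \<comment> \<open>Expanding the square and using \<open>fix_gap\<close> leaves a decrease of
    \<open>lam k * (a - lam k)\<close> times the squared displacement.\<close>
  have fejer: "(norm (z (Suc k) - zs))\<^sup>2 + \<tau> * (norm (d k))\<^sup>2 \<le> (norm (z k - zs))\<^sup>2" for k
  proof -
    have "(norm (z (Suc k) - zs))\<^sup>2
        = (norm (z k - zs))\<^sup>2 - 2 * lam k * ((z k - zs) \<bullet> d k) + (lam k)\<^sup>2 * (norm (d k))\<^sup>2"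
      unfolding step power2_norm_eq_inner
      by (simp add: inner_simps inner_commute algebra_simps power2_eq_square)
    moreover have "2 * lam k * (a / 2 * (norm (d k))\<^sup>2) \<le> 2 * lam k * ((z k - zs) \<bullet> d k)"
      using fix_gap lam by (intro mult_left_mono) (auto intro: less_imp_le)
    moreover have "\<tau> * (norm (d k))\<^sup>2 \<le> lam k * (a - lam k) * (norm (d k))\<^sup>2"
      using \<tau> by (intro mult_right_mono) auto
    ultimately show ?thesis by (simp add: algebra_simps power2_eq_square)
  qed
  have sum: "(norm (z n - zs))\<^sup>2 + \<tau> * (\<Sum>k<n. (norm (d k))\<^sup>2) \<le> D\<^sup>2" for n
  proof (induction n)
    case (Suc n)
    with fejer[of n] show ?case by (simp add: algebra_simps)
  qed (simp add: D_def)
  have sum': "\<tau> * (\<Sum>k<n. (norm (d k))\<^sup>2) \<le> D\<^sup>2" for n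
    using sum[of n] zero_le_power2[of "norm (z n - zs)"] by linarith
  have "(norm (z k - zs))\<^sup>2 \<le> D\<^sup>2"
  proof -
    have "0 \<le> \<tau> * (\<Sum>k<k. (norm (d k))\<^sup>2)" using \<tau> by (simp add: sum_nonneg)
    then show ?thesis using sum[of k] by linarith
  qed
  then show "norm (z k - zs) \<le> norm (z 0 - zs)" unfolding D_def by (simp add: power2_le_iff_abs_le)
  \<comment> \<open>\<open>pair_gap\<close> is used at consecutive iterates, whose difference is
    \<open>- lam k *\<^sub>R d k\<close>. Since \<open>lam k < a\<close>, the factor
    \<open>a\<close> may be lowered to \<open>lam k\<close>, which then cancels.\<close>
  have dec: "(norm (d (Suc k)))\<^sup>2 \<le> (norm (d k))\<^sup>2" for k
  proof -
    let ?e = "d (Suc k) - d k"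
    have "a / 2 * (norm ?e)\<^sup>2 \<le> - lam k * (d k \<bullet> ?e)"
      using pair_gap[of "Suc k" k] by (simp add: step)
    moreover have "lam k / 2 * (norm ?e)\<^sup>2 \<le> a / 2 * (norm ?e)\<^sup>2"
      using lam by (intro mult_right_mono) (auto intro: less_imp_le)
    ultimately have "lam k * ((norm ?e)\<^sup>2 + 2 * (d k \<bullet> ?e)) \<le> 0" by (simp add: algebra_simps)
    then have "(norm ?e)\<^sup>2 + 2 * (d k \<bullet> ?e) \<le> 0" using lam by (simp add: mult_le_0_iff not_le[symmetric])
    moreover have "(norm (d (Suc k)))\<^sup>2 = (norm (d k))\<^sup>2 + ((norm ?e)\<^sup>2 + 2 * (d k \<bullet> ?e))"
      unfolding power2_norm_eq_inner by (simp add: inner_simps inner_commute algebra_simps)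
    ultimately show ?thesis by linarith
  qed
  have "decseq (\<lambda>k. (norm (d k))\<^sup>2)" using dec by (simp add: decseq_Suc_iff)
  \<comment> \<open>\<open>norm (d k)\<close> is the smallest of the first \<open>k + 1\<close>
    displacements, so \<open>k + 1\<close> copies of its square fit under the bound for their
    sum.\<close>
  have "\<tau> * (real (k + 1) * (norm (d k))\<^sup>2) \<le> D\<^sup>2"
  proof -
    have "real (k + 1) * (norm (d k))\<^sup>2 = (\<Sum>i<Suc k. (norm (d k))\<^sup>2)" by simp
    also have "\<dots> \<le> (\<Sum>i<Suc k. (norm (d i))\<^sup>2)"
      using \<open>decseq _\<close> by (intro sum_mono) (auto simp: decseq_def)
    finally have "\<tau> * (real (k + 1) * (norm (d k))\<^sup>2) \<le> \<tau> * (\<Sum>i<Suc k. (norm (d i))\<^sup>2)"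
      using \<tau> by (intro mult_left_mono) auto
    with sum'[of "Suc k"] show ?thesis by linarith
  qed
  then have "sqrt (\<tau> * real (k + 1) * (norm (d k))\<^sup>2) \<le> sqrt (D\<^sup>2)"
    by (intro real_sqrt_le_mono) (simp add: algebra_simps)
  then have "sqrt (\<tau> * real (k + 1)) * norm (d k) \<le> D" by (simp add: real_sqrt_mult D_def)
  moreover have "0 < sqrt (\<tau> * real (k + 1))" using \<tau> by simp
  ultimately show "norm (d k) \<le> norm (z 0 - zs) / sqrt (\<tau> * real (k + 1))"
    unfolding D_def[symmetric] by (simp add: pos_le_divide_eq mult.commute)
  have "summable (\<lambda>k. (norm (d k))\<^sup>2)"
    using sum' \<tau> by (intro summableI_nonneg_bounded[where x = "D\<^sup>2 / \<tau>"]) (auto simp: field_simps)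
  with \<open>decseq _\<close> have "(\<lambda>k. real (Suc k) * (norm (d k))\<^sup>2) \<longlonglongrightarrow> 0"
    by (rule decseq_summable_imp_mult_tendsto_0)
  then have "(\<lambda>k. sqrt (real (Suc k) * (norm (d k))\<^sup>2)) \<longlonglongrightarrow> sqrt 0" by (rule tendsto_real_sqrt)
  then show "(\<lambda>k. sqrt (real (k + 1)) * norm (d k)) \<longlonglongrightarrow> 0" by (simp add: real_sqrt_mult)
qed

subsection \<open>Subgradients and the forward-backward displacement\<close>

lemma subdifferential_real_ineq:
  assumes f: "proper_closed_convex f" and u: "u \<in> subdifferential f x" and y: "y \<in> edom f"
  shows "f x = ereal (real_of_ereal (f x))" "f y = ereal (real_of_ereal (f y))"
    and "real_of_ereal (f x) - real_of_ereal (f y) \<le> (x - y) \<bullet> u"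
proof -
  have "f x \<noteq> - \<infinity>" "f y \<noteq> - \<infinity>" "f y \<noteq> \<infinity>"
    using f y by (auto simp: proper_closed_convex_def edom_def)
  moreover have le: "f x + ereal (u \<bullet> (y - x)) \<le> f y" using u by (simp add: subdifferential_def)
  ultimately obtain a b where ab: "f x = ereal a" "f y = ereal b" by (cases "f x"; cases "f y") auto
  show "f x = ereal (real_of_ereal (f x))" "f y = ereal (real_of_ereal (f y))"
    "real_of_ereal (f x) - real_of_ereal (f y) \<le> (x - y) \<bullet> u"
    using le by (auto simp: ab inner_simps inner_commute)
qed

text \<open>Restricted to the line through \<open>x\<close> and \<open>y\<close>, the function is
  convex in one real variable and lies above its tangent at parameter 0; this is evaluated at
  parameter 1.\<close>

lemma gradient_real_ineq:
  assumes h: "proper_closed_convex h" and grad: "has_gradient h dh"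
  shows "real_of_ereal (h x) - real_of_ereal (h y) \<le> (x - y) \<bullet> dh x"
proof -
  define H where "H = (\<lambda>x. real_of_ereal (h x))"
  have hH: "h y = ereal (H y)" for y
    using grad by (auto simp: has_gradient_def H_def ereal_real)
  have cv: "H ((1 - t) *\<^sub>R x + t *\<^sub>R y) \<le> (1 - t) * H x + t * H y" if "0 < t" "t < 1" for x y t
  proof -
    have "(x, H x) \<in> epi h" "(y, H y) \<in> epi h" by (auto simp: epi_def hH)
    moreover have "convex (epi h)" using h by (simp add: proper_closed_convex_def)
    ultimately have "(1 - t) *\<^sub>R (x, H x) + t *\<^sub>R (y, H y) \<in> epi h"
      using that by (intro convexD) auto
    then show ?thesis by (simp add: epi_def hH)
  qed
  define \<phi> where "\<phi> = (\<lambda>t::real. H (x + t *\<^sub>R (y - x)))"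
  have "convex_on UNIV \<phi>"
  proof
    fix t a b :: real assume t: "0 < t" "t < 1"
    have "x + ((1 - t) *\<^sub>R a + t *\<^sub>R b) *\<^sub>R (y - x)
        = (1 - t) *\<^sub>R (x + a *\<^sub>R (y - x)) + t *\<^sub>R (x + b *\<^sub>R (y - x))"
      by (simp add: algebra_simps)
    then show "\<phi> ((1 - t) *\<^sub>R a + t *\<^sub>R b) \<le> (1 - t) * \<phi> a + t * \<phi> b"
      unfolding \<phi>_def using cv[OF t] by metis
  qed simp
  moreover have "(\<phi> has_field_derivative (y - x) \<bullet> dh x) (at 0)"
  proof -
    have "(H has_derivative (\<lambda>v. v \<bullet> dh x)) (at (x + 0 *\<^sub>R (y - x)))"
      using grad by (simp add: has_gradient_def H_def gderiv_def)
    moreover have "((\<lambda>t::real. x + t *\<^sub>R (y - x)) has_derivative (\<lambda>t. t *\<^sub>R (y - x))) (at 0)"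
      by (auto intro!: derivative_eq_intros)
    ultimately have "(H \<circ> (\<lambda>t. x + t *\<^sub>R (y - x)) has_derivative (\<lambda>v. v \<bullet> dh x) \<circ> (\<lambda>t. t *\<^sub>R (y - x))) (at 0)"
      by (rule diff_chain_at[rotated])
    then show ?thesis
      unfolding has_field_derivative_def \<phi>_def o_def
      by (simp add: mult.commute[of _ "(y - x) \<bullet> dh x"])
  qed
  ultimately have "(y - x) \<bullet> dh x * (1 - 0) \<le> \<phi> 1 - \<phi> 0"
    by (intro convex_on_imp_above_tangent[where A = UNIV]) auto
  then show ?thesis by (simp add: \<phi>_def H_def inner_simps)
qed

lemma cocoercive_norm_le:
  assumes "cocoercive \<beta> C" "0 < \<beta>"
  shows "norm (C x - C y) \<le> norm (x - y) / \<beta>"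
proof -
  have "\<beta> * (norm (C x - C y))\<^sup>2 \<le> norm (C x - C y) * norm (x - y)"
    using assms(1) norm_cauchy_schwarz[of "C x - C y" "x - y"]
    by (auto simp: cocoercive_def intro: order_trans)
  then have "\<beta> * norm (C x - C y) \<le> norm (x - y)" if "C x \<noteq> C y"
    by (rule_tac mult_right_le_imp_le[where c = "norm (C x - C y)"])
      (use that in \<open>simp_all add: power2_eq_square mult_ac\<close>)
  then show ?thesis using assms(2) by (cases "C x = C y") (auto simp: field_simps)
qed

text \<open>With \<open>x\<close> a difference of points and \<open>u\<close> the scaled difference
  of operator values, this is the nonexpansiveness of resolvents.\<close>

lemma inner_nonneg_imp_norm_le:
  fixes x u :: "'a::real_inner"
  assumes "0 \<le> u \<bullet> x"
  shows "norm x \<le> norm (x + u)"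
  by (rule power2_le_imp_le)
    (use assms in \<open>auto simp: power2_norm_eq_inner inner_simps inner_commute\<close>)

text \<open>Here \<open>p\<close>, \<open>q\<close>, \<open>v\<close>, \<open>u\<close>,
  \<open>c\<close> stand for differences, between two runs of the splitting step, of
  \<open>xB\<close>, \<open>xA\<close>, \<open>uB\<close>, \<open>uA\<close> and the values of
  \<open>C\<close>. The inequality is the averagedness of \<open>T\<close> in displacement form:
  pair \<open>gap\<close> with \<open>d\<close>, and let cocoercivity absorb the indefinite term
  \<open>c \<bullet> d\<close>.\<close>

lemma splitting_gap_lower_bound:
  fixes p q u v c :: "'a::real_inner"
  assumes \<beta>: "0 < \<beta>" and \<gamma>: "0 < \<gamma>"
    and v: "0 \<le> v \<bullet> p" and u: "0 \<le> u \<bullet> q" and c: "\<beta> * (norm c)\<^sup>2 \<le> c \<bullet> p"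
    and gap: "p - q = \<gamma> *\<^sub>R (v + u + c)"
  shows "(1 - \<gamma> / (4 * \<beta>)) * (norm (p - q))\<^sup>2 \<le> (p + \<gamma> *\<^sub>R v) \<bullet> (p - q)"
proof -
  define d where "d = p - q"
  have "p \<bullet> d = \<gamma> * (v \<bullet> p + u \<bullet> p + c \<bullet> p)"
    unfolding d_def gap by (simp add: inner_simps inner_commute)
  moreover have "u \<bullet> p = u \<bullet> q + u \<bullet> d" by (simp add: d_def inner_simps)
  ultimately have "p \<bullet> d = \<gamma> * (v \<bullet> p + u \<bullet> q + c \<bullet> p) + \<gamma> * (u \<bullet> d)"
    by (simp add: algebra_simps)
  moreover have "0 + 0 + \<beta> * (norm c)\<^sup>2 \<le> v \<bullet> p + u \<bullet> q + c \<bullet> p"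
    using v u c by (intro add_mono)
  then have "\<gamma> * (\<beta> * (norm c)\<^sup>2) \<le> \<gamma> * (v \<bullet> p + u \<bullet> q + c \<bullet> p)"
    using \<gamma> by (intro mult_left_mono) auto
  moreover have "\<gamma> * (u \<bullet> d) + \<gamma> * (v \<bullet> d) = (norm d)\<^sup>2 - \<gamma> * (c \<bullet> d)"
  proof -
    have "d \<bullet> d = \<gamma> * (v \<bullet> d + u \<bullet> d + c \<bullet> d)"
      using arg_cong[OF gap, of "\<lambda>t. t \<bullet> d"] by (simp add: d_def[symmetric] inner_simps)
    then show ?thesis by (simp add: power2_norm_eq_inner algebra_simps)
  qed
  \<comment> \<open>Young's inequality, weighted so that the \<open>c\<close> term is exactly what
    cocoercivity pays for.\<close>
  moreover have "(norm d)\<^sup>2 / (4 * \<beta>) \<ge> c \<bullet> d - \<beta> * (norm c)\<^sup>2"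
  proof -
    have "0 \<le> (norm ((2 * \<beta>) *\<^sub>R c - d))\<^sup>2" by simp
    also have "\<dots> = 4 * \<beta>\<^sup>2 * (norm c)\<^sup>2 - 4 * \<beta> * (c \<bullet> d) + (norm d)\<^sup>2"
      unfolding power2_norm_eq_inner by (simp add: inner_simps inner_commute power2_eq_square)
    finally show ?thesis using \<beta> by (simp add: field_simps power2_eq_square)
  qed
  then have "\<gamma> * (c \<bullet> d - \<beta> * (norm c)\<^sup>2) \<le> \<gamma> * ((norm d)\<^sup>2 / (4 * \<beta>))"
    using \<gamma> by (intro mult_left_mono) auto
  ultimately show ?thesis
    unfolding d_def[symmetric] by (simp add: inner_simps algebra_simps)
qed

subsection \<open>Convergence rates\<close>

theorem corollaryD4:
  fixes f g h :: "'a::{real_inner, complete_space} \<Rightarrow> ereal"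
    and dh :: "'a \<Rightarrow> 'a"
    and Abar Bbar A B :: "'a \<Rightarrow> 'a set"
    and Cbar C T :: "'a \<Rightarrow> 'a"
    and \<beta>h \<beta>Cbar \<beta> \<epsilon> \<gamma> \<alpha> \<tau> :: real
    and lam :: "nat \<Rightarrow> real"
    and zs xs :: 'a
    and z xA xB uA uB gf gg uAbar uBbar :: "nat \<Rightarrow> 'a"
  assumes f: "proper_closed_convex f"
    and g: "proper_closed_convex g"
    and h: "proper_closed_convex h"
    and h_grad: "has_gradient h dh"
    and \<beta>h: "\<beta>h > 0"
    and dh_lip: "(1 / \<beta>h)-lipschitz_on UNIV dh"
    and Abar: "monotone_op Abar"
    and Bbar: "monotone_op Bbar"
    and Cbar: "monotone_op (\<lambda>x. {Cbar x})"
    and \<beta>Cbar: "\<beta>Cbar > 0"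
    and Cbar_coco: "cocoercive \<beta>Cbar Cbar"
    and A_eq: "A = (\<lambda>x. subdifferential f x + Abar x)"
    and A_max: "maximal_monotone_op A"
    and B_eq: "B = (\<lambda>x. subdifferential g x + Bbar x)"
    and B_max: "maximal_monotone_op B"
    and C_eq: "C = (\<lambda>x. dh x + Cbar x)"
    and \<beta>: "\<beta> > 0"
    and C_coco: "cocoercive \<beta> C"
    and \<epsilon>: "\<epsilon> \<in> {0<..<1}"
    and \<gamma>: "\<gamma> \<in> {0<..<2 * \<beta> * \<epsilon>}"
    and \<alpha>: "\<alpha> = 1 / (2 - \<epsilon>)"
    and lam: "\<forall>j. lam j \<in> {0<..<1 / \<alpha>}"
    and \<tau>_eq: "\<tau> = (INF j. lam j * (1 - \<alpha> * lam j) / \<alpha>)"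
    and \<tau>_pos: "\<tau> > 0"
    and T_eq: "T = splitting_op \<gamma> A B C"
    and fixpoint: "T zs = zs"
    and xs: "xs = resolvent (scale_op \<gamma> B) zs"
    and z_step: "\<forall>k. z (Suc k) = (1 - lam k) *\<^sub>R z k + lam k *\<^sub>R T (z k)"
    and xB: "\<forall>k. xB k = resolvent (scale_op \<gamma> B) (z k)"
    and xA: "\<forall>k. xA k = resolvent (scale_op \<gamma> A) (2 *\<^sub>R xB k - z k - \<gamma> *\<^sub>R C (xB k))"
    and uB: "\<forall>k. uB k = (1 / \<gamma>) *\<^sub>R (z k - xB k)"
    and uA: "\<forall>k. uA k = (1 / \<gamma>) *\<^sub>R (2 *\<^sub>R xB k - z k - \<gamma> *\<^sub>R C (xB k) - xA k)"
    and uA_dec: "\<forall>k. uA k = gf k + uAbar k \<and> gf k \<in> subdifferential f (xA k) \<and> uAbar k \<in> Abar (xA k)"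
    and uB_dec: "\<forall>k. uB k = gg k + uBbar k \<and> gg k \<in> subdifferential g (xB k) \<and> uBbar k \<in> Bbar (xB k)"
  shows
    "(\<forall>k. \<forall>x \<in> edom f \<inter> edom g.
        f (xA k) + g (xB k) + h (xB k) - (f x + g x + h x)
          + ereal ((xA k - x) \<bullet> uAbar k + (xB k - x) \<bullet> (uBbar k + Cbar (xB k)))
        \<le> ereal ((norm (zs - x) + (1 + \<gamma> / \<beta>) * norm (z 0 - zs) + \<gamma> * norm (C xs)) * norm (z 0 - zs)
                  / (\<gamma> * sqrt (\<tau> * real (k + 1)))))
     \<and>
     (\<forall>Lf LAbar.
        elipschitz_on Lf (cball xs ((1 + \<gamma> / \<beta>) * norm (z 0 - zs))) f \<and>
        op_lipschitz_on LAbar (cball xs ((1 + \<gamma> / \<beta>) * norm (z 0 - zs))) Abar \<longrightarrow>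
        (\<forall>k. \<forall>x \<in> edom f \<inter> edom g.
           f (xB k) + g (xB k) + h (xB k) - (f x + g x + h x)
             + ereal ((xB k - x) \<bullet> (the_elem (Abar (xB k)) + uBbar k + Cbar (xB k)))
           \<le> ereal (((norm (zs - x) + (1 + \<gamma> / \<beta>) * norm (z 0 - zs) + \<gamma> * norm (C xs)) * norm (z 0 - zs)
                       + \<gamma> * Lf * norm (z 0 - zs))
                     / (\<gamma> * sqrt (\<tau> * real (k + 1)))
                   + (1 + LAbar) * norm (z 0 - zs)
                       * ((1 + \<gamma> / \<beta>) * (1 + LAbar) * norm (z 0 - zs)
                            + norm (the_elem (Abar xs)) + norm (xs - x))
                     / sqrt (\<tau> * real (k + 1))))
        \<and>
        (\<exists>e. e \<in> o(\<lambda>k. 1 / sqrt (real (k + 1))) \<and>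
           (\<forall>k. \<forall>x \<in> edom f \<inter> edom g.
              f (xB k) + g (xB k) + h (xB k) - (f x + g x + h x)
                + ereal ((xB k - x) \<bullet> (the_elem (Abar (xB k)) + uBbar k + Cbar (xB k)))
              \<le> ereal ((1 + norm x) * e k))))"
proof -

  \<comment> \<open>Relaxation constants, with \<open>a\<close> equal to 1 / \<alpha>\<close>
  define a where "a = 2 - \<epsilon>"
  have \<gamma>0: "0 < \<gamma>" and \<epsilon>0: "0 < \<epsilon>" "\<epsilon> < 1" and a: "1 < a" "a < 2" "1 / \<alpha> = a"
    using \<gamma> \<epsilon> by (auto simp: \<alpha> a_def)
  have lam': "0 < lam k" "lam k < a" for k using lam a by auto
  have \<tau>_le: "\<tau> \<le> lam k * (a - lam k)" for k
  proof -
    have "lam j * (1 - \<alpha> * lam j) / \<alpha> = lam j * (a - lam j)" for j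
      using a by (simp add: \<alpha> a_def field_simps)
    then have "\<tau> = (INF j. lam j * (a - lam j))" by (simp add: \<tau>_eq)
    also have "\<dots> \<le> lam k * (a - lam k)"
      \<comment> \<open>A real infimum is a lower bound only if the family is bounded below;
        positivity of the terms gives the bound 0.\<close>
      by (rule cINF_lower) (use lam' in \<open>auto intro!: bdd_belowI2[where m = 0] mult_nonneg_nonneg less_imp_le\<close>)
    finally show ?thesis .
  qed
  have A_mono: "monotone_op A" and B_mono: "monotone_op B"
    using A_max B_max by (simp_all add: maximal_monotone_op_def)

  define d where "d k = xB k - xA k" for k
  \<comment> \<open>The counterparts of \<open>uB\<close> and \<open>uA\<close> at the fixed point;
    \<open>us\<close> is chosen so that the displacement
    \<open>\<gamma> *\<^sub>R (vs + us + C xs)\<close> vanishes. Their memberships rest on Minty's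
    theorem, while those at the iterates come from the given decompositions.\<close>
  define vs us where "vs = (1 / \<gamma>) *\<^sub>R (zs - xs)" and "us = - vs - C xs"
  have uB_mem: "uB k \<in> B (xB k)" and uA_mem: "uA k \<in> A (xA k)" for k
    using uA_dec uB_dec by (auto simp: A_eq B_eq intro: set_plus_intro)
  have vs_mem: "vs \<in> B xs"
    unfolding vs_def xs by (rule resolvent_mem[OF B_max \<gamma>0])
  have us_mem: "us \<in> A xs"
  proof -
    have res: "resolvent (scale_op \<gamma> A) (2 *\<^sub>R xs - zs - \<gamma> *\<^sub>R C xs) = xs"
      using fixpoint by (simp add: T_eq splitting_op_def xs[symmetric] algebra_simps)
    have "us = (1 / \<gamma>) *\<^sub>R (2 *\<^sub>R xs - zs - \<gamma> *\<^sub>R C xs - xs)"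
      using \<gamma>0 by (simp add: us_def vs_def algebra_simps scaleR_2)
    then show ?thesis
      using resolvent_mem[OF A_max \<gamma>0, of "2 *\<^sub>R xs - zs - \<gamma> *\<^sub>R C xs"] by (simp add: res)
  qed
  have z_eq: "z k = xB k + \<gamma> *\<^sub>R uB k" for k using uB \<gamma>0 by simp
  have zs_eq: "zs = xs + \<gamma> *\<^sub>R vs" using \<gamma>0 by (simp add: vs_def)
  have d_eq: "d k = \<gamma> *\<^sub>R (uB k + uA k + C (xB k))" for k
    unfolding d_def uA[rule_format] uB[rule_format] using \<gamma>0
    by (simp add: algebra_simps scaleR_2)
  have T_z: "T (z k) = z k - d k" for k
    by (simp add: T_eq splitting_op_def d_def xB xA)

  \<comment> \<open>Averagedness of the splitting operator\<close>
  have gap: "a / 2 * (norm (p1 - q1 - (p2 - q2)))\<^sup>2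
        \<le> (p1 + \<gamma> *\<^sub>R v1 - (p2 + \<gamma> *\<^sub>R v2)) \<bullet> (p1 - q1 - (p2 - q2))"
    if "v1 \<in> B p1" "u1 \<in> A q1" "p1 - q1 = \<gamma> *\<^sub>R (v1 + u1 + C p1)"
      "v2 \<in> B p2" "u2 \<in> A q2" "p2 - q2 = \<gamma> *\<^sub>R (v2 + u2 + C p2)" for p1 q1 v1 u1 p2 q2 v2 u2
  proof -
    have eq: "p1 - q1 - (p2 - q2) = (p1 - p2) - (q1 - q2)"
      "p1 + \<gamma> *\<^sub>R v1 - (p2 + \<gamma> *\<^sub>R v2) = (p1 - p2) + \<gamma> *\<^sub>R (v1 - v2)"
      by (simp_all add: algebra_simps)
    have "(p1 - p2) - (q1 - q2) = (p1 - q1) - (p2 - q2)" by simp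
    also have "\<dots> = \<gamma> *\<^sub>R ((v1 - v2) + (u1 - u2) + (C p1 - C p2))"
      unfolding that(3,6) by (simp add: algebra_simps)
    finally have "(1 - \<gamma> / (4 * \<beta>)) * (norm ((p1 - p2) - (q1 - q2)))\<^sup>2
        \<le> ((p1 - p2) + \<gamma> *\<^sub>R (v1 - v2)) \<bullet> ((p1 - p2) - (q1 - q2))"
      using that A_mono B_mono C_coco \<beta> \<gamma>0
      by (intro splitting_gap_lower_bound[where u = "u1 - u2" and c = "C p1 - C p2"])
        (auto simp: monotone_op_def cocoercive_def)
    \<comment> \<open>The step size restriction enters here: it gives \<gamma> / (4 \<beta>) <
      \<epsilon> / 2, and \<open>a / 2\<close> is 1 - \<epsilon> / 2.\<close>
    moreover have "a / 2 \<le> 1 - \<gamma> / (4 * \<beta>)" using \<gamma> \<beta> by (simp add: a_def field_simps)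
    ultimately show ?thesis
      unfolding eq by (meson mult_right_mono order_trans zero_le_power2)
  qed
  have pair_gap: "a / 2 * (norm (d j - d k))\<^sup>2 \<le> (z j - z k) \<bullet> (d j - d k)" for j k
    unfolding d_def z_eq
    by (rule gap) (use uA_mem uB_mem d_eq in \<open>auto simp: d_def\<close>)
  \<comment> \<open>The second run is the fixed point, with \<open>xs\<close> in both roles and zero
    displacement.\<close>
  have fix_gap: "a / 2 * (norm (d k))\<^sup>2 \<le> (z k - zs) \<bullet> d k" for k
    using gap[OF uB_mem[of k] uA_mem[of k] _ vs_mem us_mem] d_eq[of k]
    by (simp add: d_def z_eq zs_eq us_def)

  \<comment> \<open>Bounds along the iteration\<close>
  define D where "D = norm (z 0 - zs)"
  have step: "z (Suc k) = z k - lam k *\<^sub>R d k" for k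
    using z_step by (simp add: T_z algebra_simps)
  note km = krasnoselskii_mann[where z = z and d = d and lam = lam and a = a, OF step lam' \<tau>_pos \<tau>_le fix_gap pair_gap]
  have z_le: "norm (z k - zs) \<le> D" for k unfolding D_def by (rule km(1))
  have d_le: "norm (d k) \<le> D / sqrt (\<tau> * real (k + 1))" for k unfolding D_def by (rule km(2))
  \<comment> \<open>Since \<open>a\<close> is at least 1, \<open>fix_gap\<close> also shows that the
    unrelaxed step \<open>T (z k) = z k - d k\<close> moves no farther from
    \<open>zs\<close>.\<close>
  have Tz_le: "norm (z k - d k - zs) \<le> D" for k
  proof -
    have "(norm (z k - d k - zs))\<^sup>2
        = (norm (z k - zs))\<^sup>2 - 2 * ((z k - zs) \<bullet> d k) + (norm (d k))\<^sup>2"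
      unfolding power2_norm_eq_inner by (simp add: inner_simps inner_commute algebra_simps)
    moreover have "1 * (norm (d k))\<^sup>2 \<le> a * (norm (d k))\<^sup>2"
      using a by (intro mult_right_mono) auto
    ultimately have "(norm (z k - d k - zs))\<^sup>2 \<le> (norm (z k - zs))\<^sup>2"
      using fix_gap[of k] by linarith
    then show ?thesis using z_le[of k] power2_le_imp_le by (meson norm_ge_zero order_trans)
  qed
  have xB_le: "norm (xB k - xs) \<le> D" for k
  proof -
    have "norm (xB k - xs) \<le> norm (xB k - xs + \<gamma> *\<^sub>R (uB k - vs))"
      using B_mono uB_mem vs_mem \<gamma>0
      by (intro inner_nonneg_imp_norm_le) (auto simp: monotone_op_def)
    also have "xB k - xs + \<gamma> *\<^sub>R (uB k - vs) = z k - zs" by (simp add: z_eq zs_eq algebra_simps)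
    finally show ?thesis using z_le[of k] by linarith
  qed
  have C_le: "\<gamma> * norm (C (xB k) - C xs) \<le> \<gamma> / \<beta> * D" for k
  proof -
    have "norm (C (xB k) - C xs) \<le> D / \<beta>"
      using cocoercive_norm_le[OF C_coco \<beta>, of "xB k" xs] divide_right_mono[OF xB_le[of k], of \<beta>] \<beta>
      by linarith
    from mult_left_mono[OF this, of \<gamma>] show ?thesis using \<gamma>0 by simp
  qed
  have D0: "0 \<le> D" by (simp add: D_def)
  \<comment> \<open>\<open>xA k\<close> is a resolvent of the point
    \<open>xB k - \<gamma> *\<^sub>R uB k - \<gamma> *\<^sub>R C (xB k)\<close>. The reflected
    difference \<open>?p - ?v\<close> is no longer than \<open>?p + ?v = z k - zs\<close> by
    monotonicity of \<open>B\<close>, and the forward term adds the share \<gamma> / \<beta> of the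
    radius.\<close>
  have xA_le: "norm (xA k - xs) \<le> (1 + \<gamma> / \<beta>) * D" for k
  proof -
    let ?p = "xB k - xs" and ?v = "\<gamma> *\<^sub>R (uB k - vs)" and ?c = "C (xB k) - C xs"
    have "norm (xA k - xs) \<le> norm (xA k - xs + \<gamma> *\<^sub>R (uA k - us))"
      using A_mono uA_mem us_mem \<gamma>0
      by (intro inner_nonneg_imp_norm_le) (auto simp: monotone_op_def)
    also have "xA k - xs + \<gamma> *\<^sub>R (uA k - us) = (?p - ?v) - \<gamma> *\<^sub>R ?c"
    proof -
      have "xA k = xB k - \<gamma> *\<^sub>R (uB k + uA k + C (xB k))"
        using d_eq[of k] by (simp add: d_def algebra_simps)
      then show ?thesis by (simp add: us_def algebra_simps)
    qed
    also have "norm \<dots> \<le> norm (?p - ?v) + \<gamma> * norm ?c"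
      using norm_triangle_ineq4[of "?p - ?v" "\<gamma> *\<^sub>R ?c"] \<gamma>0 by simp
    also have "norm (?p - ?v) \<le> norm (?p + ?v)"
    proof (rule power2_le_imp_le)
      have "0 \<le> ?v \<bullet> ?p"
        using B_mono uB_mem vs_mem \<gamma>0 by (auto simp: monotone_op_def)
      then show "(norm (?p - ?v))\<^sup>2 \<le> (norm (?p + ?v))\<^sup>2"
        using dot_norm[of ?p ?v] dot_norm_neg[of ?p ?v] by (simp add: inner_commute)
    qed simp
    also have "?p + ?v = z k - zs" by (simp add: z_eq zs_eq algebra_simps)
    finally show ?thesis using z_le[of k] C_le[of k] by (simp add: algebra_simps)
  qed

  \<comment> \<open>The fundamental inequality in real arithmetic\<close>
  define fr gr hr where "fr x = real_of_ereal (f x)" and "gr x = real_of_ereal (g x)"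
    and "hr x = real_of_ereal (h x)" for x
  have f_xA: "f (xA k) = ereal (fr (xA k))" and g_xB: "g (xB k) = ereal (gr (xB k))"
    and f_x: "f x = ereal (fr x)" and g_x: "g x = ereal (gr x)" and h_y: "h y = ereal (hr y)"
    and f_ineq: "fr (xA k) - fr x \<le> (xA k - x) \<bullet> gf k"
    and g_ineq: "gr (xB k) - gr x \<le> (xB k - x) \<bullet> gg k"
    and h_ineq: "hr (xB k) - hr x \<le> (xB k - x) \<bullet> dh (xB k)"
    if "x \<in> edom f \<inter> edom g" for x y k
    using subdifferential_real_ineq[OF f, of "gf k" "xA k" x] subdifferential_real_ineq[OF g, of "gg k" "xB k" x]
      gradient_real_ineq[OF h h_grad, of "xB k" x] uA_dec uB_dec that h_grad
    unfolding fr_def gr_def hr_def by (auto simp: has_gradient_def ereal_real)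
  define N where "N x = norm (zs - x) + (1 + \<gamma> / \<beta>) * D + \<gamma> * norm (C xs)" for x
  have N0: "0 \<le> N x" for x using \<gamma>0 \<beta> D0 by (simp add: N_def)
  have main: "fr (xA k) + gr (xB k) + hr (xB k) - (fr x + gr x + hr x)
        + ((xA k - x) \<bullet> uAbar k + (xB k - x) \<bullet> (uBbar k + Cbar (xB k)))
      \<le> norm (d k) * (N x / \<gamma>)" if x: "x \<in> edom f \<inter> edom g" for x k
  proof -
    let ?w = "z k - d k - x + \<gamma> *\<^sub>R C (xB k)"
    have "fr (xA k) + gr (xB k) + hr (xB k) - (fr x + gr x + hr x)
        + ((xA k - x) \<bullet> uAbar k + (xB k - x) \<bullet> (uBbar k + Cbar (xB k)))
      \<le> (xA k - x) \<bullet> uA k + (xB k - x) \<bullet> (uB k + C (xB k))"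
      using f_ineq[OF x, of k] g_ineq[OF x, of k] h_ineq[OF x, of k] uA_dec uB_dec
      by (simp add: C_eq inner_add_right)
    also have "\<dots> = (d k \<bullet> ?w) / \<gamma>"
    proof -
      have w: "?w = xB k - x - \<gamma> *\<^sub>R uA k" by (simp add: z_eq d_eq algebra_simps)
      have xA': "xA k = xB k - d k" by (simp add: d_def)
      have "\<gamma> * ((xB k - x) \<bullet> (uA k + uB k + C (xB k))) = (xB k - x) \<bullet> d k"
        by (simp add: d_eq inner_add_right algebra_simps)
      then have "d k \<bullet> ?w = \<gamma> * ((xB k - x) \<bullet> (uA k + uB k + C (xB k)) - d k \<bullet> uA k)"
        unfolding w by (simp add: inner_diff_right inner_commute right_diff_distrib)
      then have "(d k \<bullet> ?w) / \<gamma> = (xB k - x) \<bullet> (uA k + uB k + C (xB k)) - d k \<bullet> uA k"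
        using \<gamma>0 by simp
      then show ?thesis unfolding xA' by (simp add: inner_simps)
    qed
    also have "\<dots> \<le> norm (d k) * N x / \<gamma>"
    proof (rule divide_right_mono)
      \<comment> \<open>Inserting \<open>zs\<close> and \<open>C xs\<close> splits \<open>?w\<close>
        into pieces whose bounds add up to \<open>N x\<close>.\<close>
      have "?w = (z k - d k - zs) + (zs - x) + \<gamma> *\<^sub>R (C (xB k) - C xs) + \<gamma> *\<^sub>R C xs"
        by (simp add: algebra_simps)
      also have "norm \<dots> \<le> norm (z k - d k - zs) + norm (zs - x)
          + \<gamma> * norm (C (xB k) - C xs) + \<gamma> * norm (C xs)"
        using \<gamma>0 by (intro order_trans[OF norm_triangle_ineq] add_mono) auto
      also have "\<dots> \<le> N x"
        using Tz_le[of k] C_le[of k] by (simp add: N_def algebra_simps)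
      finally show "d k \<bullet> ?w \<le> norm (d k) * N x"
        by (intro order_trans[OF norm_cauchy_schwarz] mult_left_mono) auto
    qed (use \<gamma>0 in simp)
    finally show ?thesis by simp
  qed
  have sq: "0 < sqrt (\<tau> * real (k + 1))" for k using \<tau>_pos by simp

  \<comment> \<open>Rate for the pair \<open>xA\<close>, \<open>xB\<close>\<close>
  have part1: "f (xA k) + g (xB k) + h (xB k) - (f x + g x + h x)
          + ereal ((xA k - x) \<bullet> uAbar k + (xB k - x) \<bullet> (uBbar k + Cbar (xB k)))
        \<le> ereal (N x * D / (\<gamma> * sqrt (\<tau> * real (k + 1))))" if x: "x \<in> edom f \<inter> edom g" for x k
  proof -
    have "norm (d k) * (N x / \<gamma>) \<le> D / sqrt (\<tau> * real (k + 1)) * (N x / \<gamma>)"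
      using d_le N0 \<gamma>0 by (intro mult_right_mono) auto
    then show ?thesis
      using main[OF x, of k] by (simp add: f_xA[OF x] g_xB[OF x] f_x[OF x] g_x[OF x] h_y[OF x] mult_ac)
  qed

  \<comment> \<open>Rates at \<open>xB\<close> under Lipschitz continuity\<close>
  define R where "R = (1 + \<gamma> / \<beta>) * D"
  have part2: "(\<forall>k. \<forall>x \<in> edom f \<inter> edom g.
           f (xB k) + g (xB k) + h (xB k) - (f x + g x + h x)
             + ereal ((xB k - x) \<bullet> (the_elem (Abar (xB k)) + uBbar k + Cbar (xB k)))
           \<le> ereal ((N x * D + \<gamma> * Lf * D) / (\<gamma> * sqrt (\<tau> * real (k + 1)))
                   + (1 + L) * D * ((1 + \<gamma> / \<beta>) * (1 + L) * D + norm (the_elem (Abar xs)) + norm (xs - x))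
                     / sqrt (\<tau> * real (k + 1))))
        \<and> (\<exists>e. e \<in> o(\<lambda>k. 1 / sqrt (real (k + 1))) \<and>
           (\<forall>k. \<forall>x \<in> edom f \<inter> edom g.
              f (xB k) + g (xB k) + h (xB k) - (f x + g x + h x)
                + ereal ((xB k - x) \<bullet> (the_elem (Abar (xB k)) + uBbar k + Cbar (xB k)))
              \<le> ereal ((1 + norm x) * e k)))"
    if f_lip: "elipschitz_on Lf (cball xs R) f" and A_lip: "op_lipschitz_on L (cball xs R) Abar" for Lf L
  proof -
    define aa where "aa x = the_elem (Abar x)" for x
    have "D \<le> R" using \<gamma>0 \<beta> D0 by (simp add: R_def algebra_simps)
    then have ballB: "xB k \<in> cball xs R" and ballA: "xA k \<in> cball xs R" and ball: "xs \<in> cball xs R" for k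
      using xB_le[of k] xA_le[of k] D0 by (auto simp: R_def dist_norm norm_minus_commute)
    have Lf: "Lf-lipschitz_on (cball xs R) fr" and L: "L-lipschitz_on (cball xs R) aa"
      using f_lip A_lip unfolding elipschitz_on_def op_lipschitz_on_def fr_def aa_def by auto
    have L0: "0 \<le> L" "0 \<le> Lf" using L Lf by (auto dest: lipschitz_on_nonneg)
    have f_xB: "f (xB k) = ereal (fr (xB k))" for k
      using f_lip ballB[of k] by (auto simp: elipschitz_on_def fr_def ereal_real)
    \<comment> \<open>Single-valuedness on the ball identifies the chosen element of the
      decomposition.\<close>
    have aa: "uAbar k = aa (xA k)" for k
    proof -
      have "is_singleton (Abar (xA k))" using A_lip ballA by (auto simp: op_lipschitz_on_def)
      then show ?thesis using uA_dec by (metis aa_def is_singleton_the_elem singletonD)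
    qed
    \<comment> \<open>\<open>M x\<close> collects the costs per unit of \<open>norm (d k)\<close>:
      the fundamental inequality, the change of \<open>f\<close>, the size of
      \<open>aa (xA k)\<close>, and the change of \<open>aa\<close> between \<open>xA k\<close> and
      \<open>xB k\<close>.\<close>
    define M where "M x = N x / \<gamma> + Lf + (norm (aa xs) + L * R + L * (D + norm (xs - x)))" for x
    have M0: "0 \<le> M x" for x using N0[of x] \<gamma>0 L0 D0 \<open>D \<le> R\<close> by (simp add: M_def)
    have main2: "f (xB k) + g (xB k) + h (xB k) - (f x + g x + h x)
             + ereal ((xB k - x) \<bullet> (the_elem (Abar (xB k)) + uBbar k + Cbar (xB k)))
          \<le> ereal (norm (d k) * M x)" if x: "x \<in> edom f \<inter> edom g" for x k
    proof -
      have "fr (xB k) - fr (xA k) \<le> norm (d k) * Lf"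
        using lipschitz_onD[OF Lf ballB[of k] ballA[of k]] by (simp add: dist_norm d_def mult.commute)
      moreover have "(xB k - x) \<bullet> aa (xB k) - (xA k - x) \<bullet> aa (xA k)
          = d k \<bullet> aa (xA k) + (xB k - x) \<bullet> (aa (xB k) - aa (xA k))"
        by (simp add: d_def inner_simps algebra_simps)
      moreover have "d k \<bullet> aa (xA k) \<le> norm (d k) * (norm (aa xs) + L * R)"
      proof -
        have "norm (aa (xA k) - aa xs) \<le> L * norm (xA k - xs)"
          using lipschitz_onD[OF L ballA[of k] ball] by (simp add: dist_norm)
        also have "\<dots> \<le> L * R" using xA_le[of k] L0 by (intro mult_left_mono) (auto simp: R_def)
        finally have "norm (aa (xA k)) \<le> norm (aa xs) + L * R"
          using norm_triangle_sub[of "aa (xA k)" "aa xs"] by linarith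
        then show ?thesis by (intro order_trans[OF norm_cauchy_schwarz] mult_left_mono) auto
      qed
      moreover have "(xB k - x) \<bullet> (aa (xB k) - aa (xA k)) \<le> norm (d k) * (L * (D + norm (xs - x)))"
      proof -
        have "norm (xB k - x) \<le> D + norm (xs - x)"
          using norm_triangle_ineq[of "xB k - xs" "xs - x"] xB_le[of k] by simp
        moreover have "norm (aa (xB k) - aa (xA k)) \<le> L * norm (d k)"
          using lipschitz_onD[OF L ballB[of k] ballA[of k]] by (simp add: dist_norm d_def)
        ultimately have "norm (xB k - x) * norm (aa (xB k) - aa (xA k)) \<le> (D + norm (xs - x)) * (L * norm (d k))"
          using D0 by (intro mult_mono) auto
        then show ?thesis
          using norm_cauchy_schwarz[of "xB k - x" "aa (xB k) - aa (xA k)"] by (simp add: mult_ac)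
      qed
      ultimately have "fr (xB k) + gr (xB k) + hr (xB k) - (fr x + gr x + hr x)
          + (xB k - x) \<bullet> (aa (xB k) + uBbar k + Cbar (xB k)) \<le> norm (d k) * M x"
        using main[OF x, of k] by (simp add: aa M_def inner_add_right distrib_left)
      then show ?thesis
        by (simp add: f_xB g_xB[OF x] f_x[OF x] g_x[OF x] h_y[OF x] aa_def)
    qed
    \<comment> \<open>The stated constant is larger than \<open>M x\<close>: expanding its product
      yields the terms of \<open>M x\<close> with \<open>R\<close> for \<open>D\<close>, plus a
      nonnegative surplus.\<close>
    have M_le: "M x \<le> N x / \<gamma> + Lf
        + (1 + L) * ((1 + \<gamma> / \<beta>) * (1 + L) * D + norm (aa xs) + norm (xs - x))" for x
    proof -
      have "(1 + L) * ((1 + \<gamma> / \<beta>) * (1 + L) * D + norm (aa xs) + norm (xs - x))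
          = (norm (aa xs) + L * R + L * (R + norm (xs - x))) + (R + L * L * R + L * norm (aa xs) + norm (xs - x))"
        by (simp add: R_def algebra_simps add_divide_distrib)
      moreover have "0 \<le> R + L * L * R + L * norm (aa xs) + norm (xs - x)"
        using L0 D0 \<open>D \<le> R\<close> by simp
      moreover have "L * (D + norm (xs - x)) \<le> L * (R + norm (xs - x))"
        using L0 \<open>D \<le> R\<close> by (intro mult_left_mono) auto
      ultimately show ?thesis by (simp add: M_def)
    qed
    have bound: "norm (d k) * M x \<le> (N x * D + \<gamma> * Lf * D) / (\<gamma> * sqrt (\<tau> * real (k + 1)))
        + (1 + L) * D * ((1 + \<gamma> / \<beta>) * (1 + L) * D + norm (aa xs) + norm (xs - x))
          / sqrt (\<tau> * real (k + 1))" for x k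
    proof -
      let ?W = "(1 + \<gamma> / \<beta>) * (1 + L) * D + norm (aa xs) + norm (xs - x)"
      have "norm (d k) * M x \<le> D / sqrt (\<tau> * real (k + 1)) * (N x / \<gamma> + Lf + (1 + L) * ?W)"
        using d_le M_le M0 D0 sq[of k] by (intro mult_mono) auto
      also have "\<dots> = (N x * D + \<gamma> * Lf * D) / (\<gamma> * sqrt (\<tau> * real (k + 1)))
          + (1 + L) * D * ?W / sqrt (\<tau> * real (k + 1))"
      proof -
        have "D / s * (n / \<gamma> + Lf + (1 + L) * w) = (n * D + \<gamma> * Lf * D) / (\<gamma> * s) + (1 + L) * D * w / s"
          if "0 < s" for s n w :: real
          using that \<gamma>0 by (simp add: field_simps)
        then show ?thesis using sq by blast
      qed
      finally show ?thesis .
    qed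
    \<comment> \<open>By the triangle inequality \<open>M x\<close> is at most
      \<open>P + norm x * (1 / \<gamma> + L)\<close>, with \<open>P\<close> as defined below.
      \<open>K\<close> is this bound at \<open>norm x = 1\<close>, so it does not depend on
      \<open>x\<close> and one error sequence \<open>norm (d k) * K\<close> serves all
      \<open>x\<close>.\<close>
    define K where "K = (norm zs + 1 + (1 + \<gamma> / \<beta>) * D + \<gamma> * norm (C xs)) / \<gamma> + Lf
      + (norm (aa xs) + L * R + L * (D + norm xs + 1))"
    have M_K: "M x \<le> (1 + norm x) * K" for x
    proof -
      define P where "P = (norm zs + (1 + \<gamma> / \<beta>) * D + \<gamma> * norm (C xs)) / \<gamma> + Lf
        + (norm (aa xs) + L * R + L * (D + norm xs))"
      have "0 \<le> P" using \<gamma>0 \<beta> D0 L0 \<open>D \<le> R\<close> by (simp add: P_def)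
      have KP: "K = P + (1 / \<gamma> + L)" by (simp add: K_def P_def add_divide_distrib algebra_simps)
      have "N x / \<gamma> \<le> (norm zs + norm x + (1 + \<gamma> / \<beta>) * D + \<gamma> * norm (C xs)) / \<gamma>"
        using \<gamma>0 norm_triangle_ineq4[of zs x] by (intro divide_right_mono) (auto simp: N_def)
      moreover have "L * (D + norm (xs - x)) \<le> L * (D + norm xs + norm x)"
        using L0 norm_triangle_ineq4[of xs x] by (intro mult_left_mono) auto
      ultimately have "M x \<le> P + norm x * (1 / \<gamma> + L)"
        by (simp add: M_def P_def add_divide_distrib algebra_simps)
      also have "\<dots> \<le> (1 + norm x) * K"
        using \<open>0 \<le> P\<close> L0 \<gamma>0 by (simp add: KP algebra_simps)
      finally show ?thesis .
    qed
    \<comment> \<open>The little-o comes from the square summability of the decreasing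
      displacements, which the explicit rate alone would not give.\<close>
    have "(\<lambda>k. norm (d k) * K) \<in> o(\<lambda>k. 1 / sqrt (real (k + 1)))"
    proof (rule smalloI_tendsto)
      show "(\<lambda>k. norm (d k) * K / (1 / sqrt (real (k + 1)))) \<longlonglongrightarrow> 0"
        using tendsto_mult_right[OF km(3), of K] by (simp add: mult_ac)
    qed simp
    moreover have "norm (d k) * M x \<le> (1 + norm x) * (norm (d k) * K)" for k x
      using mult_left_mono[OF M_K[of x], of "norm (d k)"] by (simp add: mult_ac)
    ultimately show ?thesis
      using main2 bound unfolding aa_def by (meson ereal_less_eq(3) order_trans)
  qed
  show ?thesis
    using part1 part2 unfolding N_def R_def D_def by blast
qed

end
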